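(* Every Namioka-Phelps locally convex space $V$ has the dual system fixed point property.
   Context: Locally convex spaces are real and Hausdorff. For a locally convex space $V$ with topological dual $V^*$, the weak$^*$ topology is $\sigma(V^*,V)$ and $\xi^*$ denotes the uniform structure on $V^*$ of uniform convergence on bounded subsets of $V$. $V$ is a Namioka-Phelps space, (NP)-space, if every equicontinuous subset $K\subset V^*$ is (weak$^*$,$\xi^*$)-fragmented: for every nonempty $A\subset K$ and every entourage $\varepsilon\in\xi^*$ there is a weak$^*$-open (in $K$) set $O\subset K$ such that $O\cap A\neq\emptyset$ and $(O\cap A)\times(O\cap A)\subset\varepsilon$. $V$ has the dual system fixed point property if the following holds: for every semigroup $S$ and every nonempty convex weak$^*$ compact set $Q\subset V^*$ equipped with an action of $S$ by affine weak$^*$-continuous maps $Q\to Q$ (so $(st)q=s(tq)$), such that (1) $Q$ is an equicontinuous subset of $V^*$, and (2) $S$ is $\xi^*$-distal on $Q$ (for every pair of distinct $x,y\in Q$ there is $\varepsilon\in\xi^*$ with $(sx,sy)\notin\varepsilon$ for all $s\in S$), there is $q\in Q$ with $sq=q$ for all $s\in S$. *)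

theory Defs
  imports "HOL-Analysis.Analysis" "HOL-Library.Function_Algebras"
begin

text \<open>Real Hausdorff locally convex spaces. Joint continuity of the scalar multiplication is
  phrased like the library's axiom for joint continuity of addition. The constant \<^const>\<open>convex\<close>
  cannot be used on the parameter of a class being declared, so it appears unfolded.\<close>

class locally_convex_space = real_vector + topological_ab_group_add + t2_space +
  assumes tendsto_scaleR_Pair:
    "LIM p (nhds r \<times>\<^sub>F nhds x). fst p *\<^sub>R snd p :> nhds (r *\<^sub>R x)"
  and locally_convex_unfolded:
    "eventually (\<lambda>x. x \<in> U) (nhds 0) \<Longrightarrow>
      \<exists>C. (\<forall>x\<in>C. \<forall>y\<in>C. \<forall>u\<ge>0. \<forall>v\<ge>0. u + v = 1 \<longrightarrow> u *\<^sub>R x + v *\<^sub>R y \<in> C) \<and>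
          C \<subseteq> U \<and> eventually (\<lambda>x. x \<in> C) (nhds 0)"

lemma locally_convex:
  fixes U :: "'v::locally_convex_space set"
  assumes "eventually (\<lambda>x. x \<in> U) (nhds 0)"
  shows "\<exists>C. convex C \<and> C \<subseteq> U \<and> eventually (\<lambda>x. x \<in> C) (nhds 0)"
  using locally_convex_unfolded[OF assms] unfolding convex_def .

text \<open>Pointwise scalar multiplication, complementing the pointwise addition of
  \<open>Function_Algebras\<close>, so that \<^const>\<open>convex\<close> applies to sets of functionals.\<close>

instantiation "fun" :: (type, real_vector) real_vector
begin

definition scaleR_fun :: "real \<Rightarrow> ('a \<Rightarrow> 'b) \<Rightarrow> 'a \<Rightarrow> 'b" where
  "scaleR_fun r f = (\<lambda>x. r *\<^sub>R f x)"

instance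
  by standard (auto simp: scaleR_fun_def fun_eq_iff scaleR_add_right scaleR_add_left)

end

definition topological_dual :: "('v::locally_convex_space \<Rightarrow> real) set" where
  "topological_dual = {f. linear f \<and> continuous_on UNIV f}"

text \<open>The library topology on a function type is the product topology, that is, the topology of
  pointwise convergence; its trace on the dual is \<open>\<sigma>(V\<^sup>*, V)\<close>.\<close>

definition weak_star :: "('v::locally_convex_space \<Rightarrow> real) topology" where
  "weak_star = top_of_set topological_dual"

text \<open>The library's \<^const>\<open>bounded\<close> is metric; in a locally convex space, bounded means absorbed by
  every neighbourhood of \<open>0\<close>.\<close>

definition lcs_bounded :: "'v::locally_convex_space set \<Rightarrow> bool" where
  "lcs_bounded B \<longleftrightarrow>
    (\<forall>U. open U \<and> 0 \<in> U \<longrightarrow> (\<exists>s>0. \<forall>t\<ge>s. B \<subseteq> (\<lambda>x. t *\<^sub>R x) ` U))"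

text \<open>The entourages of the uniformity \<open>\<xi>\<^sup>*\<close> of uniform convergence on bounded sets.\<close>

definition xi_star :: "(('v::locally_convex_space \<Rightarrow> real) \<times> ('v \<Rightarrow> real)) set set" where
  "xi_star = {E. E \<subseteq> topological_dual \<times> topological_dual \<and>
    (\<exists>B e. lcs_bounded B \<and> 0 < e \<and>
      {(f, g). f \<in> topological_dual \<and> g \<in> topological_dual \<and>
               (\<forall>v\<in>B. \<bar>f v - g v\<bar> < e)} \<subseteq> E)}"

definition equicontinuous :: "('v::locally_convex_space \<Rightarrow> real) set \<Rightarrow> bool" where
  "equicontinuous K \<longleftrightarrow>
    (\<forall>x. \<forall>e>0. \<exists>U. open U \<and> x \<in> U \<and> (\<forall>f\<in>K. \<forall>y\<in>U. \<bar>f y - f x\<bar> < e))"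

text \<open>Fragmentedness of \<open>K\<close> with respect to a topology \<open>T\<close> and a uniformity with entourages
  \<open>\<E>\<close>.\<close>

definition fragmented :: "'a topology \<Rightarrow> ('a \<times> 'a) set set \<Rightarrow> 'a set \<Rightarrow> bool" where
  "fragmented T \<E> K \<longleftrightarrow>
    (\<forall>A E. A \<noteq> {} \<and> A \<subseteq> K \<and> E \<in> \<E> \<longrightarrow>
      (\<exists>W. openin (subtopology T K) W \<and> W \<inter> A \<noteq> {} \<and> (W \<inter> A) \<times> (W \<inter> A) \<subseteq> E))"

definition namioka_phelps :: "'v::locally_convex_space itself \<Rightarrow> bool" where
  "namioka_phelps _ \<longleftrightarrow>
    (\<forall>K::('v \<Rightarrow> real) set. K \<subseteq> topological_dual \<and> equicontinuous K \<longrightarrow>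
      fragmented weak_star xi_star K)"

definition affine_map_on :: "'a::real_vector set \<Rightarrow> ('a \<Rightarrow> 'b::real_vector) \<Rightarrow> bool" where
  "affine_map_on Q h \<longleftrightarrow>
    (\<forall>x\<in>Q. \<forall>y\<in>Q. \<forall>u\<ge>0. \<forall>v\<ge>0. u + v = 1 \<longrightarrow>
      h (u *\<^sub>R x + v *\<^sub>R y) = u *\<^sub>R h x + v *\<^sub>R h y)"

definition affine_weak_star_action ::
    "('s::semigroup_mult \<Rightarrow> ('v::locally_convex_space \<Rightarrow> real) \<Rightarrow> ('v \<Rightarrow> real)) \<Rightarrow>
     ('v \<Rightarrow> real) set \<Rightarrow> bool" where
  "affine_weak_star_action act Q \<longleftrightarrow>
    (\<forall>s. act s ` Q \<subseteq> Q) \<and>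
    (\<forall>s t. \<forall>q\<in>Q. act (s * t) q = act s (act t q)) \<and>
    (\<forall>s. affine_map_on Q (act s)) \<and>
    (\<forall>s. continuous_map (subtopology weak_star Q) (subtopology weak_star Q) (act s))"

definition xi_star_distal ::
    "('s \<Rightarrow> ('v::locally_convex_space \<Rightarrow> real) \<Rightarrow> ('v \<Rightarrow> real)) \<Rightarrow>
     ('v \<Rightarrow> real) set \<Rightarrow> bool" where
  "xi_star_distal act Q \<longleftrightarrow>
    (\<forall>x\<in>Q. \<forall>y\<in>Q. x \<noteq> y \<longrightarrow> (\<exists>E\<in>xi_star. \<forall>s. (act s x, act s y) \<notin> E))"

text \<open>A definition cannot quantify over types, so the semigroup is a type parameter; the dual
  system fixed point property of \<open>V\<close> is this predicate for every type \<open>'s\<close>.\<close>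

definition dual_system_fixed_point_property ::
    "'s::semigroup_mult itself \<Rightarrow> 'v::locally_convex_space itself \<Rightarrow> bool" where
  "dual_system_fixed_point_property _ _ \<longleftrightarrow>
    (\<forall>(Q :: ('v \<Rightarrow> real) set) (act :: 's \<Rightarrow> ('v \<Rightarrow> real) \<Rightarrow> ('v \<Rightarrow> real)).
      Q \<noteq> {} \<and> Q \<subseteq> topological_dual \<and> convex Q \<and> compactin weak_star Q \<and>
      affine_weak_star_action act Q \<and>
      equicontinuous Q \<and>
      xi_star_distal act Q \<longrightarrow>
      (\<exists>q\<in>Q. \<forall>s. act s q = q))"

end

theory Submission
  imports Defs
begin

text \<open>
  The argument is that of Namioka and Asplund for the Ryll-Nardzewski theorem, with fragmentability
  providing the small slices.

  By compactness of \<open>Q\<close> it suffices to find a common fixed point of finitely many semigroup elements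
  \<open>s\<close> in \<open>I\<close>. The average \<open>T\<close> of their actions is an affine continuous self-map of \<open>Q\<close> and has
  a fixed point \<open>x\<close> (lemma \<open>affine_fixed_point\<close>). Suppose that some \<open>s\<close> in \<open>I\<close> moves \<open>x\<close>.
  Distality yields one entourage \<open>E\<close>, given by a bounded set, such that \<open>t s x\<close> and \<open>t x\<close> are never
  \<open>E\<close>-close, whatever \<open>t\<close> and whichever \<open>s\<close> moving \<open>x\<close>. Let \<open>Y\<close> be the closure of the orbit
  of \<open>x\<close>. If \<open>Y\<close> has a nonempty slice \<open>{g \<in> Y. \<alpha> < g v}\<close> all of whose points are \<open>E\<close>-close
  to each other, then some \<open>t x\<close> lies in that slice. As \<open>t x\<close> is the average of the points
  \<open>t s x\<close>, one of these with \<open>s\<close> moving \<open>x\<close> has at least the same value at \<open>v\<close>, so it lies in the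
  slice too, and this contradicts the choice of \<open>E\<close>.

  The existence of small slices (lemma \<open>small_slice\<close>) is what fragmentability is used for.
  By itself it gives relatively weak-star open sets that are small, which need not contain slices.
  The remedy is a closed subset \<open>X\<close> of \<open>Y\<close> that is minimal among those on which every evaluation
  attains its maximum over \<open>Y\<close>: if an open set \<open>W\<close> meets \<open>X\<close> in a small set, then \<open>Y\<close> has
  a nonempty slice whose points are close to \<open>W \<inter> X\<close>. This \<open>X\<close> replaces the closure of the set of
  extreme points in the usual proof: Zorn's lemma produces it, and the maxima of evaluations at
  suitable vectors replace the convex hulls that are formed there with the Krein-Milman theorem.
\<close>

section \<open>Compact sets of real functions\<close>

lemma compact_imp_closed_fun:
  fixes Q :: "('a \<Rightarrow> 'b::metric_space) set"
  assumes "compact Q"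
  shows "closed Q"
proof -
  have "Hausdorff_space (euclidean :: ('a \<Rightarrow> 'b) topology)"
    unfolding euclidean_product_topology[symmetric] Hausdorff_space_product_topology
    by (simp add: Hausdorff_space_euclidean)
  then show ?thesis
    using assms compactin_imp_closedin by fastforce
qed

lemma continuous_on_eval: "continuous_on S (\<lambda>f. f v :: 'b::topological_space)"
  by (rule continuous_on_product_then_coordinatewise) (rule continuous_on_id)

text \<open>For compact \<open>Y\<close> and \<open>X \<subseteq> Y\<close>, this says that every evaluation attains its maximum over
  \<open>Y\<close> at a point of \<open>X\<close>.\<close>

definition norming :: "('a \<Rightarrow> real) set \<Rightarrow> ('a \<Rightarrow> real) set \<Rightarrow> bool" where
  "norming Y X \<longleftrightarrow> (\<forall>g\<in>Y. \<forall>v. \<exists>f\<in>X. g v \<le> f v)"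

text \<open>The minimal closed set is \<open>Y - U\<close>; passing to complements turns the search for a minimal
  closed set into one for a maximal open set, to which Zorn's lemma for set inclusion applies. The
  intersection of a chain of closed norming sets is norming because, for each \<open>g\<close> and \<open>v\<close>, their
  intersections with the closed set \<open>{f. g v \<le> f v}\<close> are nonempty, compact and nested.\<close>

lemma minimal_norming_subset:
  fixes Y :: "('a \<Rightarrow> real) set"
  assumes "compact Y"
  obtains U where "open U" "norming Y (Y - U)"
    "\<And>W. open W \<Longrightarrow> W \<inter> (Y - U) \<noteq> {} \<Longrightarrow> \<not> norming Y (Y - U - W)"
proof -
  define \<A> where "\<A> = {U. open U \<and> norming Y (Y - U)}"
  have "\<Union>\<C> \<in> \<A>" if chain: "subset.chain \<A> \<C>" for \<C>
  proof -
    have C: "open U" "norming Y (Y - U)" if "U \<in> \<C>" for U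
      using chain that by (auto simp: subset_chain_def \<A>_def)
    have "\<exists>f\<in>Y - \<Union>\<C>. g v \<le> f v" if g: "g \<in> Y" for g v
    proof -
      have cl: "closed {f. g v \<le> f v}"
        by (intro closed_Collect_le continuous_on_const continuous_on_eval)
      have "(Y \<inter> {f. g v \<le> f v}) \<inter> (\<Inter>U\<in>\<C>. - U) \<noteq> {}"
      proof (rule compact_imp_fip_image)
        show "compact (Y \<inter> {f. g v \<le> f v})"
          using assms cl by (rule compact_Int_closed)
        show "closed (- U)" if "U \<in> \<C>" for U
          using C(1)[OF that] by (rule closed_Compl)
        fix \<D> assume \<D>: "finite \<D>" "\<D> \<subseteq> \<C>"
        show "(Y \<inter> {f. g v \<le> f v}) \<inter> (\<Inter>U\<in>\<D>. - U) \<noteq> {}"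
        proof (cases "\<D> = {}")
          case True
          then show ?thesis using g by auto
        next
          case False
          have "subset.chain \<A> \<D>"
            using chain \<D>(2) unfolding subset_chain_def by blast
          then have "\<Union>\<D> \<in> \<D>" using Union_in_chain \<D>(1) False by blast
          then have "norming Y (Y - \<Union>\<D>)" using C(2) \<D>(2) by blast
          then show ?thesis using g unfolding norming_def by blast
        qed
      qed
      then show ?thesis by auto
    qed
    then show ?thesis using C(1) by (auto simp: \<A>_def norming_def)
  qed
  then have "\<exists>U\<in>\<A>. \<forall>V\<in>\<A>. U \<subseteq> V \<longrightarrow> V = U"
    by (rule subset_Zorn')
  then obtain U where U: "U \<in> \<A>" and max: "\<And>V. V \<in> \<A> \<Longrightarrow> U \<subseteq> V \<Longrightarrow> V = U"
    by blast
  show ?thesis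
  proof (rule that[of U])
    show "open U" "norming Y (Y - U)" using U by (auto simp: \<A>_def)
    fix W assume W: "open W" "W \<inter> (Y - U) \<noteq> {}"
    show "\<not> norming Y (Y - U - W)"
    proof
      assume "norming Y (Y - U - W)"
      moreover have "Y - U - W = Y - (U \<union> W)" by blast
      ultimately have "U \<union> W \<in> \<A>"
        using W(1) \<open>open U\<close> by (auto simp: \<A>_def)
      from max[OF this] W(2) show False by blast
    qed
  qed
qed

text \<open>Let \<open>W\<close> be a small open set that meets the minimal norming set \<open>X = Y - U\<close>. As \<open>X - W\<close> is
  not norming, some evaluation at \<open>v\<close> is at most a number \<open>a\<close> on \<open>X - W\<close>, while its maximum over
  \<open>Y\<close> is \<open>b > a\<close>. A point \<open>g\<close> of \<open>Y\<close> for which \<open>g v\<close> is near \<open>b\<close> must be near \<open>f0 \<in> W \<inter> X\<close>.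
  To see this, compare \<open>g\<close> with a point \<open>f\<close> of \<open>X\<close> that dominates it at \<open>u + t v\<close> with
  \<open>t\<close> large: the term \<open>t v\<close> forces \<open>f\<close> into \<open>W\<close>, and then \<open>g u\<close> exceeds \<open>f u\<close> by at most
  \<open>t (b - g v)\<close>, which is small if the slice is thin. Replacing \<open>u\<close> by \<open>-u\<close> gives the lower
  bound.\<close>

lemma small_slice:
  fixes Y :: "('v::real_vector \<Rightarrow> real) set"
  assumes Y: "compact Y" "Y \<noteq> {}" "\<And>f. f \<in> Y \<Longrightarrow> linear f"
    and bound: "\<And>f u. f \<in> Y \<Longrightarrow> u \<in> B \<Longrightarrow> \<bar>f u\<bar> \<le> M" and "0 \<le> M"
    and "0 < e"
    and frag: "\<And>A. A \<noteq> {} \<Longrightarrow> A \<subseteq> Y \<Longrightarrow>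
      \<exists>W. open W \<and> W \<inter> A \<noteq> {} \<and> (\<forall>f\<in>W \<inter> A. \<forall>g\<in>W \<inter> A. \<forall>u\<in>B. \<bar>f u - g u\<bar> \<le> e)"
  obtains v \<alpha> where "\<exists>g\<in>Y. \<alpha> < g v"
    "\<And>g h u. g \<in> Y \<Longrightarrow> h \<in> Y \<Longrightarrow> \<alpha> < g v \<Longrightarrow> \<alpha> < h v \<Longrightarrow> u \<in> B \<Longrightarrow> \<bar>g u - h u\<bar> \<le> 4 * e"
proof -
  obtain U where U: "open U" "norming Y (Y - U)"
    and min: "\<And>W. open W \<Longrightarrow> W \<inter> (Y - U) \<noteq> {} \<Longrightarrow> \<not> norming Y (Y - U - W)"
    using minimal_norming_subset[OF Y(1)] by blast
  have "Y - U \<noteq> {}" using U(2) Y(2) unfolding norming_def by blast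
  then obtain W where W: "open W" "W \<inter> (Y - U) \<noteq> {}"
    and small: "\<And>f g u. f \<in> W \<inter> (Y - U) \<Longrightarrow> g \<in> W \<inter> (Y - U) \<Longrightarrow> u \<in> B \<Longrightarrow> \<bar>f u - g u\<bar> \<le> e"
    using frag[of "Y - U"] by blast
  obtain f0 where f0: "f0 \<in> W \<inter> (Y - U)" using W(2) by blast
  obtain g1 v where g1: "g1 \<in> Y" and less: "\<And>f. f \<in> Y - U - W \<Longrightarrow> f v < g1 v"
    using min[OF W] unfolding norming_def by (auto simp: not_le)
  obtain fb where fb: "fb \<in> Y" and "\<forall>f\<in>Y. f v \<le> fb v"
    using continuous_attains_sup[OF Y(1,2) continuous_on_eval] by blast
  define b where "b = fb v"
  have le_b: "f v \<le> b" if "f \<in> Y" for f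
    using \<open>\<forall>f\<in>Y. f v \<le> fb v\<close> that by (simp add: b_def)
  have "compact (Y - U - W)" using Y(1) U(1) W(1) by (intro compact_diff)
  obtain a where "a < b" and le_a: "\<And>f. f \<in> Y - U - W \<Longrightarrow> f v \<le> a"
  proof (cases "Y - U - W = {}")
    case True
    show ?thesis by (rule that[of "b - 1"]) (use True in auto)
  next
    case False
    then obtain fa where fa: "fa \<in> Y - U - W" "\<forall>f\<in>Y - U - W. f v \<le> fa v"
      using continuous_attains_sup[OF \<open>compact (Y - U - W)\<close> False continuous_on_eval] by blast
    show ?thesis
    proof (rule that[of "fa v"])
      show "fa v < b" using less[OF fa(1)] le_b[OF g1] by simp
    qed (use fa(2) in blast)
  qed
  \<comment> \<open>With this \<open>t\<close> a gap of \<open>(b - a) / 2\<close> at \<open>v\<close> outweighs any difference \<open>2 M\<close> at points of \<open>B\<close>;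
      \<open>d\<close> keeps the slice above the midpoint of \<open>a\<close> and \<open>b\<close> and bounds \<open>t (b - g v)\<close> by \<open>e\<close>.\<close>
  define t where "t = 4 * (M + 1) / (b - a)"
  define d where "d = min ((b - a) / 2) (e / t)"
  have "0 < t" using \<open>a < b\<close> \<open>0 \<le> M\<close> by (simp add: t_def)
  then have "0 < d" using \<open>a < b\<close> \<open>0 < e\<close> by (simp add: d_def)
  have "t * d \<le> e" using \<open>0 < t\<close> by (simp add: d_def min_def field_simps)
  have key: "\<sigma> * g u - \<sigma> * f0 u \<le> 2 * e"
    if g: "g \<in> Y" "b - d < g v" and u: "u \<in> B" and \<sigma>: "\<sigma> = 1 \<or> \<sigma> = -1" for g u and \<sigma> :: real
  proof -
    obtain f where f: "f \<in> Y - U" "g (\<sigma> *\<^sub>R u + t *\<^sub>R v) \<le> f (\<sigma> *\<^sub>R u + t *\<^sub>R v)"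
      using U(2) g(1) unfolding norming_def by blast
    have *: "h (\<sigma> *\<^sub>R u + t *\<^sub>R v) = \<sigma> * h u + t * h v" if "h \<in> Y" for h
      using Y(3)[OF that] by (simp add: linear_add linear_scale)
    have le: "t * (g v - f v) \<le> \<sigma> * f u - \<sigma> * g u"
      using f *[of f] *[OF g(1)] by (simp add: algebra_simps)
    have "f \<in> W"
    proof (rule ccontr)
      assume "f \<notin> W"
      then have "f v \<le> a" using f(1) le_a by blast
      moreover have "d \<le> (b - a) / 2" unfolding d_def by (rule min.cobounded1)
      ultimately have "(b - a) / 2 \<le> g v - f v" using g(2) by argo
      then have "t * ((b - a) / 2) \<le> t * (g v - f v)"
        using \<open>0 < t\<close> by simp
      moreover have "t * ((b - a) / 2) = 2 * M + 2"
        using \<open>a < b\<close> by (simp add: t_def field_simps)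
      moreover have "\<sigma> * f u - \<sigma> * g u \<le> 2 * M"
        using bound[OF _ u, of f] bound[OF g(1) u] f(1) \<sigma> by auto
      ultimately show False using le by linarith
    qed
    then have "\<sigma> * f u - \<sigma> * f0 u \<le> e"
      using small[OF _ f0 u, of f] f(1) \<sigma> by auto
    moreover have "t * (f v - g v) \<le> t * d"
      using le_b[of f] f(1) g(2) \<open>0 < t\<close> by simp
    ultimately show ?thesis
      using le \<open>t * d \<le> e\<close> by (simp add: algebra_simps)
  qed
  have near: "\<bar>g u - f0 u\<bar> \<le> 2 * e" if "g \<in> Y" "b - d < g v" "u \<in> B" for g u
    using key[OF that, of 1] key[OF that, of "-1"] by simp
  show ?thesis
  proof (rule that[of "b - d" v])
    show "\<exists>g\<in>Y. b - d < g v" using fb \<open>0 < d\<close> by (intro bexI[of _ fb]) (simp_all add: b_def)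
    show "\<bar>g u - h u\<bar> \<le> 4 * e"
      if "g \<in> Y" "h \<in> Y" "b - d < g v" "b - d < h v" "u \<in> B" for g h u
      using near[of g u] near[of h u] that by linarith
  qed
qed

section \<open>Affine self-maps of compact convex sets\<close>

text \<open>The graph of an affine map on a convex set is convex, so it is closed under finite convex
  combinations.\<close>

lemma affine_map_on_sum:
  assumes "affine_map_on Q h" "convex Q" "finite I" "\<And>i. i \<in> I \<Longrightarrow> x i \<in> Q"
    "\<And>i. i \<in> I \<Longrightarrow> 0 \<le> a i" "sum a I = 1"
  shows "h (\<Sum>i\<in>I. a i *\<^sub>R x i) = (\<Sum>i\<in>I. a i *\<^sub>R h (x i))"
proof -
  have "convex ((\<lambda>x. (x, h x)) ` Q)"
  proof (rule convexI, elim imageE)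
    fix p q x y and u v :: real
    assume *: "0 \<le> u" "0 \<le> v" "u + v = 1" "x \<in> Q" "y \<in> Q" "p = (x, h x)" "q = (y, h y)"
    then have "u *\<^sub>R p + v *\<^sub>R q = (u *\<^sub>R x + v *\<^sub>R y, h (u *\<^sub>R x + v *\<^sub>R y))"
      using assms(1) by (simp add: affine_map_on_def)
    then show "u *\<^sub>R p + v *\<^sub>R q \<in> (\<lambda>x. (x, h x)) ` Q"
      using convexD[OF assms(2) *(4,5,1,2,3)] by (rule image_eqI)
  qed
  then have "(\<Sum>i\<in>I. a i *\<^sub>R (x i, h (x i))) \<in> (\<lambda>x. (x, h x)) ` Q"
    using assms by (intro convex_sum) auto
  then show ?thesis
    by (auto simp: prod_eq_iff fst_sum snd_sum)
qed

lemma affine_map_on_average: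
  assumes "\<And>i. i \<in> I \<Longrightarrow> affine_map_on Q (h i)"
  shows "affine_map_on Q (\<lambda>x. \<Sum>i\<in>I. c *\<^sub>R h i x)"
  unfolding affine_map_on_def
proof (intro ballI allI impI)
  fix x y and u v :: real
  assume *: "x \<in> Q" "y \<in> Q" "0 \<le> u" "0 \<le> v" "u + v = 1"
  have "(\<Sum>i\<in>I. c *\<^sub>R h i (u *\<^sub>R x + v *\<^sub>R y))
    = (\<Sum>i\<in>I. u *\<^sub>R c *\<^sub>R h i x + v *\<^sub>R c *\<^sub>R h i y)"
    using assms * by (intro sum.cong) (simp_all add: affine_map_on_def scaleR_add_right mult.commute)
  then show "(\<Sum>i\<in>I. c *\<^sub>R h i (u *\<^sub>R x + v *\<^sub>R y))
    = u *\<^sub>R (\<Sum>i\<in>I. c *\<^sub>R h i x) + v *\<^sub>R (\<Sum>i\<in>I. c *\<^sub>R h i y)"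
    by (simp only: sum.distrib scaleR_sum_right)
qed

text \<open>The average of the first \<open>n\<close> iterates of a point is moved by \<open>T\<close> by the \<open>n\<close>-th part of a
  difference of two points of \<open>Q\<close>, since the sum of the displacements telescopes. Coordinatewise
  this tends to \<open>0\<close> at a rate that depends on the coordinate alone, so the points that are moved so
  little form a decreasing sequence of nonempty closed subsets of \<open>Q\<close>, and any point in their
  intersection is fixed.\<close>

lemma affine_fixed_point:
  fixes Q :: "('a \<Rightarrow> real) set"
  assumes Q: "compact Q" "convex Q" "Q \<noteq> {}"
    and T: "T ` Q \<subseteq> Q" "continuous_on Q T" "affine_map_on Q T"
  shows "\<exists>q\<in>Q. T q = q"
proof -
  obtain q where q: "q \<in> Q" using Q(3) by blast
  have pow: "(T ^^ n) q \<in> Q" for n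
    by (induction n) (use q T(1) in auto)
  have average: "\<exists>x\<in>Q. T x - x = (1 / real (Suc n)) *\<^sub>R ((T ^^ Suc n) q - q)" for n
  proof (induction n)
    case 0
    then show ?case using q by auto
  next
    case (Suc n)
    then obtain x where x: "x \<in> Q" "T x - x = (1 / real (Suc n)) *\<^sub>R ((T ^^ Suc n) q - q)"
      by blast
    \<comment> \<open>The next average is the convex combination of \<open>x\<close> with the next iterate \<open>y\<close>, weighted by \<open>u\<close>.\<close>
    define u where "u = 1 / real (Suc (Suc n))"
    define y where "y = (T ^^ Suc n) q"
    have u: "0 \<le> u" "0 \<le> 1 - u" "(1 - u) * (1 / real (Suc n)) = u"
      by (simp_all add: u_def field_simps)
    have y: "y \<in> Q" "T y = (T ^^ Suc (Suc n)) q" using pow[of "Suc n"] by (simp_all add: y_def)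
    have "T ((1 - u) *\<^sub>R x + u *\<^sub>R y) - ((1 - u) *\<^sub>R x + u *\<^sub>R y)
      = (1 - u) *\<^sub>R (T x - x) + u *\<^sub>R (T y - y)"
    proof -
      have "T ((1 - u) *\<^sub>R x + u *\<^sub>R y) = (1 - u) *\<^sub>R T x + u *\<^sub>R T y"
        using T(3) x(1) y(1) u(1,2) by (simp add: affine_map_on_def)
      then show ?thesis by (simp add: algebra_simps)
    qed
    also have "\<dots> = u *\<^sub>R (y - q) + u *\<^sub>R (T y - y)"
      by (simp only: x(2) scaleR_scaleR u(3) y_def)
    also have "\<dots> = u *\<^sub>R (T y - q)" by (simp add: algebra_simps)
    finally have "T ((1 - u) *\<^sub>R x + u *\<^sub>R y) - ((1 - u) *\<^sub>R x + u *\<^sub>R y)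
      = (1 / real (Suc (Suc n))) *\<^sub>R ((T ^^ Suc (Suc n)) q - q)"
      unfolding y(2) u_def .
    moreover have "(1 - u) *\<^sub>R x + u *\<^sub>R y \<in> Q"
      by (rule convexD[OF Q(2) x(1) y(1) u(2,1)]) simp
    ultimately show ?case by (rule bexI)
  qed
  have "\<exists>M. \<forall>f\<in>Q. \<bar>f v\<bar> \<le> M" for v
    using compact_imp_bounded[OF compact_continuous_image[OF continuous_on_eval Q(1)], of v]
    by (auto simp: bounded_iff)
  then obtain M where M: "\<And>f v. f \<in> Q \<Longrightarrow> \<bar>f v\<bar> \<le> M v" by metis
  have M0: "0 \<le> M v" for v using M[OF q, of v] by linarith
  define C where "C n = (\<Inter>v. {x\<in>Q. \<bar>T x v - x v\<bar> \<le> 2 * M v / real (Suc n)})" for n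
  have "Q \<inter> (\<Inter>n\<in>UNIV. C n) \<noteq> {}"
  proof (rule compact_imp_fip_image[OF Q(1)])
    have "closed {x\<in>Q. \<bar>T x v - x v\<bar> \<le> c}" for v c
    proof -
      have "continuous_on Q (\<lambda>x. \<bar>T x v - x v\<bar>)"
        by (intro continuous_on_rabs continuous_on_diff continuous_on_eval
            continuous_on_product_then_coordinatewise[OF T(2)])
      from continuous_closed_preimage[OF this compact_imp_closed_fun[OF Q(1)] closed_atMost]
      show ?thesis by (simp add: vimage_def Collect_conj_eq)
    qed
    then show "closed (C n)" for n unfolding C_def by (intro closed_INT) blast
    fix N :: "nat set" assume "finite N"
    then obtain m where m: "\<And>n. n \<in> N \<Longrightarrow> n \<le> m" using finite_nat_set_iff_bounded_le by auto
    obtain x where x: "x \<in> Q" "T x - x = (1 / real (Suc m)) *\<^sub>R ((T ^^ Suc m) q - q)"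
      using average by blast
    have "x \<in> C n" if "n \<in> N" for n
    proof -
      have "\<bar>T x v - x v\<bar> \<le> 2 * M v / real (Suc n)" for v
      proof -
        have "T x v - x v = ((T ^^ Suc m) q v - q v) / real (Suc m)"
          using fun_cong[OF x(2), of v] by (simp add: scaleR_fun_def)
        also have "\<bar>\<dots>\<bar> = \<bar>(T ^^ Suc m) q v - q v\<bar> / real (Suc m)"
          by (simp add: abs_divide)
        also have "\<dots> \<le> 2 * M v / real (Suc n)"
        proof (rule frac_le)
          show "\<bar>(T ^^ Suc m) q v - q v\<bar> \<le> 2 * M v"
            using M[OF pow, of "Suc m" v] M[OF q, of v] by linarith
        qed (use m[OF that] M0 in simp_all)
        finally show ?thesis .
      qed
      then show ?thesis using x(1) by (simp add: C_def)
    qed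
    then show "Q \<inter> (\<Inter>n\<in>N. C n) \<noteq> {}" using x(1) by blast
  qed
  then obtain x where x: "x \<in> Q" "\<And>n. x \<in> C n" by blast
  have "T x v = x v" for v
  proof -
    have "(\<lambda>n. 2 * M v / real (Suc n)) \<longlonglongrightarrow> 0"
      by (rule LIMSEQ_Suc) (rule lim_const_over_n)
    then have "\<bar>T x v - x v\<bar> \<le> 0"
      by (rule LIMSEQ_le_const) (use x(2) in \<open>auto simp: C_def\<close>)
    then show ?thesis by simp
  qed
  then show ?thesis using x(1) by blast
qed

section \<open>Bounded sets and equicontinuity\<close>

lemma lcs_bounded_Un:
  assumes "lcs_bounded A" "lcs_bounded B"
  shows "lcs_bounded (A \<union> B)"
  unfolding lcs_bounded_def
proof (intro allI impI)
  fix U :: "'a set" assume U: "open U \<and> 0 \<in> U"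
  obtain r s where "0 < r" "\<And>t. t \<ge> r \<Longrightarrow> A \<subseteq> (\<lambda>x. t *\<^sub>R x) ` U"
      "0 < s" "\<And>t. t \<ge> s \<Longrightarrow> B \<subseteq> (\<lambda>x. t *\<^sub>R x) ` U"
    using assms U unfolding lcs_bounded_def by meson
  then show "\<exists>s>0. \<forall>t\<ge>s. A \<union> B \<subseteq> (\<lambda>x. t *\<^sub>R x) ` U"
    by (intro exI[of _ "max r s"]) auto
qed

lemma lcs_bounded_Union:
  assumes "finite I" "\<And>i. i \<in> I \<Longrightarrow> lcs_bounded (B i)"
  shows "lcs_bounded (\<Union>i\<in>I. B i)"
  using assms
proof (induction I rule: finite_induct)
  case empty
  then show ?case by (auto simp: lcs_bounded_def intro: exI[of _ 1])
next
  case (insert i I)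
  then show ?case using lcs_bounded_Un by auto
qed

lemma equicontinuous_imp_uniformly_bounded:
  assumes "equicontinuous K" "K \<subseteq> topological_dual" "lcs_bounded B"
  obtains M where "0 \<le> M" "\<And>f u. f \<in> K \<Longrightarrow> u \<in> B \<Longrightarrow> \<bar>f u\<bar> \<le> M"
proof -
  have lin: "linear f" if "f \<in> K" for f using assms(2) that by (auto simp: topological_dual_def)
  obtain U where U: "open U" "0 \<in> U" "\<And>f y. f \<in> K \<Longrightarrow> y \<in> U \<Longrightarrow> \<bar>f y - f 0\<bar> < 1"
    using assms(1) unfolding equicontinuous_def by (meson zero_less_one)
  obtain s where s: "0 < s" "B \<subseteq> (\<lambda>x. s *\<^sub>R x) ` U"
    using assms(3) U(1,2) unfolding lcs_bounded_def by (meson order_refl)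
  have "\<bar>f u\<bar> \<le> s" if f: "f \<in> K" and "u \<in> B" for f u
  proof -
    obtain y where y: "y \<in> U" "u = s *\<^sub>R y" using s(2) \<open>u \<in> B\<close> by blast
    have "\<bar>f y\<bar> < 1" using U(3)[OF f y(1)] linear_0[OF lin[OF f]] by simp
    then show ?thesis using s(1) by (simp add: y(2) linear_scale[OF lin[OF f]] abs_mult)
  qed
  then show ?thesis using that[of s] s(1) by simp
qed

section \<open>Fixed points of distal affine actions\<close>

text \<open>Finiteness is needed twice: for the average whose fixed point \<open>x\<close> is the candidate, and for
  merging the entourages that separate the orbits of \<open>s x\<close> and \<open>x\<close> into a single one.\<close>

lemma distal_common_fixed_point_finite:
  fixes act :: "'s::semigroup_mult \<Rightarrow> ('v::locally_convex_space \<Rightarrow> real) \<Rightarrow> ('v \<Rightarrow> real)"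
  assumes Q: "Q \<noteq> {}" "Q \<subseteq> topological_dual" "convex Q" "compact Q" "equicontinuous Q"
    and frag: "fragmented weak_star xi_star Q"
    and act: "\<And>s q. q \<in> Q \<Longrightarrow> act s q \<in> Q"
      "\<And>s t q. q \<in> Q \<Longrightarrow> act (s * t) q = act s (act t q)"
      "\<And>s. affine_map_on Q (act s)" "\<And>s. continuous_on Q (act s)"
    and distal: "xi_star_distal act Q"
    and I: "finite I"
  shows "\<exists>q\<in>Q. \<forall>s\<in>I. act s q = q"
proof (cases "I = {}")
  case True
  then show ?thesis using Q(1) by blast
next
  case False
  define c where "c = 1 / real (card I)"
  have c: "0 < c" "(\<Sum>s\<in>I. c) = 1"
    using I False by (simp_all add: c_def card_gt_0_iff)
  define T where "T x = (\<Sum>s\<in>I. c *\<^sub>R act s x)" for x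
  have T_apply: "T x v = (\<Sum>s\<in>I. c * act s x v)" for x v
  proof -
    have "(\<Sum>s\<in>J. c *\<^sub>R act s x) v = (\<Sum>s\<in>J. c * act s x v)" for J
      by (induction J rule: infinite_finite_induct) (auto simp: scaleR_fun_def)
    then show ?thesis by (simp add: T_def)
  qed
  have "\<exists>q\<in>Q. T q = q"
  proof (rule affine_fixed_point[OF Q(4,3,1)])
    show "T ` Q \<subseteq> Q"
      using c act(1) Q(3) I by (auto simp: T_def intro!: convex_sum)
    show "affine_map_on Q T"
      unfolding T_def using act(3) by (intro affine_map_on_average)
    show "continuous_on Q T"
    proof (rule continuous_on_coordinatewise_then_product)
      show "continuous_on Q (\<lambda>x. T x v)" for v
        unfolding T_apply
        by (intro continuous_on_sum continuous_on_mult continuous_on_const)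
          (rule continuous_on_product_then_coordinatewise[OF act(4)])
    qed
  qed
  then obtain x where x: "x \<in> Q" "T x = x" by blast
  have T_act: "act t x = (\<Sum>s\<in>I. c *\<^sub>R act t (act s x))" for t
    using affine_map_on_sum[OF act(3) Q(3) I, of "\<lambda>s. act s x" "\<lambda>_. c" t] c act(1) x
    by (simp add: T_def)
  have average: "(\<Sum>s\<in>I. act t (act s x) v - act t x v) = 0" for t v
  proof -
    have "(\<Sum>s\<in>J. c *\<^sub>R act t (act s x)) v = c * (\<Sum>s\<in>J. act t (act s x) v)" for J
      by (induction J rule: infinite_finite_induct) (auto simp: scaleR_fun_def algebra_simps)
    then have "act t x v = c * (\<Sum>s\<in>I. act t (act s x) v)" by (subst T_act)
    then show ?thesis using I False by (simp add: sum_subtractf c_def)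
  qed
  define J where "J = {s\<in>I. act s x \<noteq> x}"
  have "finite J" using I by (simp add: J_def)
  show ?thesis
  proof (rule ccontr)
    assume "\<not> ?thesis"
    then have "J \<noteq> {}" using x(1) by (auto simp: J_def)
    have "\<exists>B e. lcs_bounded B \<and> 0 < e \<and> (\<forall>t. \<exists>u\<in>B. e \<le> \<bar>act t (act s x) u - act t x u\<bar>)"
      if s: "s \<in> J" for s
    proof -
      have "act s x \<in> Q" "act s x \<noteq> x" using s x(1) act(1) by (auto simp: J_def)
      then obtain E where "E \<in> xi_star" and E: "\<And>t. (act t (act s x), act t x) \<notin> E"
        using distal x(1) unfolding xi_star_distal_def by blast
      then obtain B e where B: "lcs_bounded B" "0 < e" "{(f, g). f \<in> topological_dual
        \<and> g \<in> topological_dual \<and> (\<forall>v\<in>B. \<bar>f v - g v\<bar> < e)} \<subseteq> E"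
        unfolding xi_star_def by blast
      have "\<exists>u\<in>B. e \<le> \<bar>act t (act s x) u - act t x u\<bar>" for t
      proof -
        have "act t (act s x) \<in> topological_dual" "act t x \<in> topological_dual"
          using act(1) x(1) Q(2) by blast+
        then show ?thesis using B(3) E[of t] by (fastforce simp: not_less)
      qed
      then show ?thesis using B(1,2) by blast
    qed
    then obtain B e where B: "\<And>s. s \<in> J \<Longrightarrow> lcs_bounded (B s)" "\<And>s. s \<in> J \<Longrightarrow> 0 < e s"
      and far: "\<And>s t. s \<in> J \<Longrightarrow> \<exists>u\<in>B s. e s \<le> \<bar>act t (act s x) u - act t x u\<bar>"
      by metis
    \<comment> \<open>Points of a slice will be within \<open>4 d\<close> of each other on \<open>BB\<close>, half of what distality excludes.\<close>
    define BB where "BB = (\<Union>s\<in>J. B s)"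
    define d where "d = Min (e ` J) / 8"
    have "0 < d" using \<open>finite J\<close> \<open>J \<noteq> {}\<close> B(2) by (simp add: d_def)
    have d: "8 * d \<le> e s" if "s \<in> J" for s using \<open>finite J\<close> that by (simp add: d_def)
    have BB: "lcs_bounded BB" unfolding BB_def using \<open>finite J\<close> B(1) by (rule lcs_bounded_Union)
    define E where "E = {(f, g). f \<in> topological_dual \<and> g \<in> topological_dual
        \<and> (\<forall>u\<in>BB. \<bar>f u - g u\<bar> < d)}"
    have E: "E \<in> xi_star" using BB \<open>0 < d\<close> by (auto simp: xi_star_def E_def)
    obtain M where M: "0 \<le> M" "\<And>f u. f \<in> Q \<Longrightarrow> u \<in> BB \<Longrightarrow> \<bar>f u\<bar> \<le> M"
      using equicontinuous_imp_uniformly_bounded[OF Q(5,2) BB] by blast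
    define Y where "Y = closure (range (\<lambda>t. act t x))"
    have YQ: "Y \<subseteq> Q"
      unfolding Y_def using act(1)[OF x(1)] compact_imp_closed_fun[OF Q(4)]
      by (intro closure_minimal) auto
    have orbit: "act t x \<in> Y" for t
      unfolding Y_def by (rule closure_subset[THEN subsetD]) simp
    obtain v \<alpha> where slice: "\<exists>g\<in>Y. \<alpha> < g v"
      and thin: "\<And>g h u. g \<in> Y \<Longrightarrow> h \<in> Y \<Longrightarrow> \<alpha> < g v \<Longrightarrow> \<alpha> < h v \<Longrightarrow> u \<in> BB
        \<Longrightarrow> \<bar>g u - h u\<bar> \<le> 4 * d"
    proof (rule small_slice[where Y = Y and B = BB and M = M and e = d])
      show "compact Y"
        using compact_Int_closed[OF Q(4), of Y] YQ by (simp add: Y_def Int_absorb1)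
      show "Y \<noteq> {}" using orbit by blast
      show "linear f" if "f \<in> Y" for f
        using that YQ Q(2) by (auto simp: topological_dual_def)
      show "\<bar>f u\<bar> \<le> M" if "f \<in> Y" "u \<in> BB" for f u
        using that YQ M(2) by blast
      show "0 \<le> M" "0 < d" by fact+
      fix A assume A: "A \<noteq> {}" "A \<subseteq> Y"
      then obtain W where W: "openin (subtopology weak_star Q) W" "W \<inter> A \<noteq> {}"
          "(W \<inter> A) \<times> (W \<inter> A) \<subseteq> E"
        using frag E YQ unfolding fragmented_def by (meson order_trans)
      obtain W' where W': "open W'" "W = Q \<inter> W'"
        using W(1) Q(2) by (auto simp: weak_star_def subtopology_subtopology Int_absorb1 openin_open)
      have "W' \<inter> A = W \<inter> A" using A(2) YQ W'(2) by blast
      then show "\<exists>W. open W \<and> W \<inter> A \<noteq> {} \<and>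
          (\<forall>f\<in>W \<inter> A. \<forall>g\<in>W \<inter> A. \<forall>u\<in>BB. \<bar>f u - g u\<bar> \<le> d)"
        using W(2,3) W'(1) by (intro exI[of _ W']) (force simp: E_def)
    qed (use that in blast)
    have "open {g. \<alpha> < g v}"
      by (intro open_Collect_less continuous_on_const continuous_on_eval)
    then have "{g. \<alpha> < g v} \<inter> range (\<lambda>t. act t x) \<noteq> {}"
      using slice open_Int_closure_eq_empty[of "{g. \<alpha> < g v}"] unfolding Y_def by blast
    then obtain t where t: "\<alpha> < act t x v" by blast
    \<comment> \<open>Elements of \<open>I\<close> that fix \<open>x\<close> contribute \<open>0\<close> to the vanishing sum of differences, so the terms
        from \<open>J\<close> already sum to \<open>0\<close> and cannot all be negative.\<close>
    have "\<exists>s\<in>J. act t x v \<le> act t (act s x) v"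
    proof (rule ccontr)
      assume "\<not> ?thesis"
      then have "(\<Sum>s\<in>J. act t (act s x) v - act t x v) < 0"
        using sum_strict_mono[OF \<open>finite J\<close> \<open>J \<noteq> {}\<close>,
            of "\<lambda>s. act t (act s x) v - act t x v" "\<lambda>_. 0"] by (simp add: not_le)
      moreover have "(\<Sum>s\<in>J. act t (act s x) v - act t x v)
          = (\<Sum>s\<in>I. act t (act s x) v - act t x v)"
        using I by (intro sum.mono_neutral_left) (auto simp: J_def)
      ultimately show False by (simp add: average)
    qed
    then obtain s where s: "s \<in> J" "act t x v \<le> act t (act s x) v" by blast
    have "act t (act s x) \<in> Y" using orbit[of "t * s"] act(2)[OF x(1)] by simp
    obtain u where u: "u \<in> B s" "e s \<le> \<bar>act t (act s x) u - act t x u\<bar>"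
      using far[OF s(1)] by blast
    have "\<bar>act t (act s x) u - act t x u\<bar> \<le> 4 * d"
      by (rule thin) (use orbit \<open>act t (act s x) \<in> Y\<close> s t u(1) in \<open>auto simp: BB_def\<close>)
    then show False using u(2) d[OF s(1)] \<open>0 < d\<close> by linarith
  qed
qed

theorem corollary1p11:
  assumes "namioka_phelps TYPE('v::locally_convex_space)"
  shows "dual_system_fixed_point_property TYPE('s::semigroup_mult) TYPE('v)"
  unfolding dual_system_fixed_point_property_def
proof (intro allI impI, elim conjE)
  fix Q :: "('v \<Rightarrow> real) set" and act :: "'s \<Rightarrow> ('v \<Rightarrow> real) \<Rightarrow> ('v \<Rightarrow> real)"
  assume Q: "Q \<noteq> {}" "Q \<subseteq> topological_dual" "convex Q" "compactin weak_star Q" "equicontinuous Q"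
    and action: "affine_weak_star_action act Q" and distal: "xi_star_distal act Q"
  have "compact Q"
    using Q(4) by (simp add: weak_star_def compactin_subtopology)
  have frag: "fragmented weak_star xi_star Q"
    using assms Q(2,5) by (simp add: namioka_phelps_def)
  have weak_star_Q: "subtopology weak_star Q = top_of_set Q"
    using Q(2) by (simp add: weak_star_def subtopology_subtopology Int_absorb1)
  have act: "\<And>s q. q \<in> Q \<Longrightarrow> act s q \<in> Q"
      "\<And>s t q. q \<in> Q \<Longrightarrow> act (s * t) q = act s (act t q)"
      "\<And>s. affine_map_on Q (act s)" "\<And>s. continuous_on Q (act s)"
    using action unfolding affine_weak_star_action_def weak_star_Q
    by (auto simp: continuous_map_in_subtopology)
  have "closed {q \<in> Q. act s q = q}" for s
  proof -
    have "closed {q \<in> Q. act s q v - q v = 0}" for v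
    proof -
      have "continuous_on Q (\<lambda>q. act s q v - q v)"
        by (intro continuous_on_diff continuous_on_eval
          continuous_on_product_then_coordinatewise[OF act(4)])
      from continuous_closed_preimage[OF this compact_imp_closed_fun[OF \<open>compact Q\<close>] closed_singleton[of 0]]
      show ?thesis by (simp add: vimage_def Collect_conj_eq)
    qed
    moreover have "{q \<in> Q. act s q = q} = (\<Inter>v. {q \<in> Q. act s q v - q v = 0})"
      by (auto simp: fun_eq_iff)
    ultimately show ?thesis by auto
  qed
  then have "Q \<inter> (\<Inter>s\<in>UNIV. {q \<in> Q. act s q = q}) \<noteq> {}"
  proof (rule compact_imp_fip_image[OF \<open>compact Q\<close>])
    fix I :: "'s set" assume "finite I"
    from distal_common_fixed_point_finite[OF Q(1-3) \<open>compact Q\<close> Q(5) frag act distal this]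
    show "Q \<inter> (\<Inter>s\<in>I. {q \<in> Q. act s q = q}) \<noteq> {}" by blast
  qed
  then show "\<exists>q\<in>Q. \<forall>s. act s q = q" by blast
qed

end
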